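(* There is an infinite strictly ascending chain $$\mathrm{Fin}<_{\mathrm{LT}}^{\mathsf o}\mathrm{ED}_{\mathrm{fin}}[1]<_{\mathrm{LT}}^{\mathsf o}\dots<_{\mathrm{LT}}^{\mathsf o}\mathrm{ED}_{\mathrm{fin}}[m]<_{\mathrm{LT}}^{\mathsf o}\mathrm{ED}_{\mathrm{fin}}[m+1]<_{\mathrm{LT}}^{\mathsf o}\dots<_{\mathrm{LT}}^{\mathsf o}\mathrm{ED}_{\mathrm{fin}}<_{\mathrm{LT}}^{\mathsf o}\mathrm{Sum}_{1/n}$$ within the Gamified Katětov order on lower sets over $\omega$.
   Context: **Upper and lower sets.** An upper set is a nonempty family $\mathcal U\subseteq\mathcal P(\omega)$, closed upwards under $\subseteq$, with $\emptyset\notin\mathcal U$. A lower set is a family $\mathcal L\subseteq\mathcal P(\omega)$ whose dual $\mathcal L^*=\{\omega\setminus A:A\in\mathcal L\}$ is an upper set. **Gamified Katětov order.** A tree is a subset $T\subseteq\omega^{<\omega}$ containing the empty string and closed under prefixes; $[T]$ is its set of infinite paths. $T$ is $\mathcal V$-branching if $\{n:\sigma^\frown n\in T\}\in\mathcal V$ for every $\sigma\in T$. A partial continuous function $\Phi\colon\subseteq\omega^\omega\to\omega$ is one determined by a partial function $\varphi\colon\subseteq\omega^{<\omega}\to\omega$ that is coherent (if $\sigma$ is a prefix of $\tau$ and both are in $\mathrm{dom}(\varphi)$ then $\varphi(\sigma)=\varphi(\tau)$) via: $\Phi(p)=c$ iff $\varphi(p\upharpoonright n)=c$ for some $n$. For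 upper sets, $\mathcal U\leq_{\mathrm{LT}}^{\mathsf o}\mathcal V$ iff there is a partial continuous $\Phi$ such that for every $A\in\mathcal U$ there is a $\mathcal V$-branching tree $T$ with $[T]\subseteq\mathrm{dom}(\Phi)$ and $\Phi(p)\in A$ for all $p\in[T]$. For lower sets, $\mathcal H\leq_{\mathrm{LT}}^{\mathsf o}\mathcal I$ iff $\mathcal H^*\leq_{\mathrm{LT}}^{\mathsf o}\mathcal I^*$. $\mathcal H<_{\mathrm{LT}}^{\mathsf o}\mathcal I$ means $\mathcal H\leq_{\mathrm{LT}}^{\mathsf o}\mathcal I$ and $\mathcal I\not\leq_{\mathrm{LT}}^{\mathsf o}\mathcal H$. **The lower sets.** $\mathrm{Fin}$ is the set of finite subsets of $\omega$. Partition $\omega$ into consecutive intervals $(I_a)_{a\in\omega}$, where $I_a$ has length $a$. For $m\geq1$, $\mathrm{ED}_{\mathrm{fin}}[m]$ is the set of all $A\subseteq\omega$ with $|A\cap I_n|\leq m$ for all but finitely many $n$; $\mathrm{ED}_{\mathrm{fin}}=\bigcup_m\mathrm{ED}_{\mathrm{fin}}[m]$. $\mathrm{Sum}_{1/n}$ is the set of all $A\subseteq\omega$ with $\sum_{n\in A,\,n>0}\frac1n<\infty$. *)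

theory Defs
  imports "HOL-Library.Infinite_Set" "HOL-Library.Sublist" "HOL-Analysis.Infinite_Sum"
begin

definition upper_set :: "nat set set \<Rightarrow> bool" where
  "upper_set U \<longleftrightarrow> U \<noteq> {} \<and> (\<forall>A\<in>U. \<forall>B. A \<subseteq> B \<longrightarrow> B \<in> U) \<and> {} \<notin> U"

definition dual_family :: "nat set set \<Rightarrow> nat set set" where
  "dual_family L = {UNIV - A | A. A \<in> L}"

definition lower_set :: "nat set set \<Rightarrow> bool" where
  "lower_set L \<longleftrightarrow> upper_set (dual_family L)"

definition is_tree :: "nat list set \<Rightarrow> bool" where
  "is_tree T \<longleftrightarrow> [] \<in> T \<and> (\<forall>\<tau>\<in>T. \<forall>\<sigma>. prefix \<sigma> \<tau> \<longrightarrow> \<sigma> \<in> T)"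

definition initial_segment :: "(nat \<Rightarrow> nat) \<Rightarrow> nat \<Rightarrow> nat list" where
  "initial_segment p n = map p [0..<n]"

definition paths :: "nat list set \<Rightarrow> (nat \<Rightarrow> nat) set" where
  "paths T = {p. \<forall>n. initial_segment p n \<in> T}"

definition branching :: "nat set set \<Rightarrow> nat list set \<Rightarrow> bool" where
  "branching V T \<longleftrightarrow> (\<forall>\<sigma>\<in>T. {n. \<sigma> @ [n] \<in> T} \<in> V)"

definition coherent :: "(nat list \<rightharpoonup> nat) \<Rightarrow> bool" where
  "coherent \<phi> \<longleftrightarrow> (\<forall>\<sigma>\<in>dom \<phi>. \<forall>\<tau>\<in>dom \<phi>. prefix \<sigma> \<tau> \<longrightarrow> \<phi> \<sigma> = \<phi> \<tau>)"

definition partial_continuous :: "((nat \<Rightarrow> nat) \<rightharpoonup> nat) \<Rightarrow> bool" where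
  "partial_continuous \<Phi> \<longleftrightarrow>
     (\<exists>\<phi>. coherent \<phi> \<and>
        (\<forall>p c. \<Phi> p = Some c \<longleftrightarrow> (\<exists>n. \<phi> (initial_segment p n) = Some c)))"

definition LT_upper :: "nat set set \<Rightarrow> nat set set \<Rightarrow> bool" where
  "LT_upper U V \<longleftrightarrow>
     (\<exists>\<Phi>. partial_continuous \<Phi> \<and>
        (\<forall>A\<in>U. \<exists>T. is_tree T \<and> branching V T \<and>
           paths T \<subseteq> dom \<Phi> \<and> (\<forall>p\<in>paths T. the (\<Phi> p) \<in> A)))"

definition LT_le :: "nat set set \<Rightarrow> nat set set \<Rightarrow> bool"  (infix "\<le>LT" 50) where
  "H \<le>LT I \<longleftrightarrow> LT_upper (dual_family H) (dual_family I)"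

definition LT_less :: "nat set set \<Rightarrow> nat set set \<Rightarrow> bool"  (infix "<LT" 50) where
  "H <LT I \<longleftrightarrow> H \<le>LT I \<and> \<not> I \<le>LT H"

definition Fin :: "nat set set" where
  "Fin = {A. finite A}"

text \<open>Consecutive intervals starting at 0, the \<open>a\<close>-th one of length \<open>a\<close>; the one for
  \<open>a = 0\<close> is empty.\<close>
definition block :: "nat \<Rightarrow> nat set" where
  "block a = {(\<Sum>i<a. i)..<(\<Sum>i<Suc a. i)}"

definition ED_fin_bound :: "nat \<Rightarrow> nat set set" where
  "ED_fin_bound m = {A. \<forall>\<^sub>\<infinity>n. card (A \<inter> block n) \<le> m}"

definition ED_fin :: "nat set set" where
  "ED_fin = (\<Union>m\<in>{1..}. ED_fin_bound m)"

definition Sum_recip :: "nat set set" where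
  "Sum_recip = {A. (\<lambda>n. 1 / real n) summable_on {n \<in> A. n > 0}}"

end

theory Submission
  imports Defs "HOL-Analysis.Summation_Tests"
begin

text \<open>
  Each reduction in the chain comes from an inclusion of lower sets: \<open>\<Phi>\<close> reads off the first
  entry of a path (\<open>LT_le_if_subset\<close>). The inclusion of \<open>ED_fin\<close> in \<open>Sum_recip\<close> holds because the
  elements of the \<open>n\<close>-th block are of order \<open>n\<^sup>2\<close>, so boundedly many elements per block have a
  convergent sum of reciprocals. As \<open>Fin = ED_fin_bound 0\<close>, the first link is the case \<open>m = 0\<close> of the
  links between the \<open>ED_fin_bound m\<close>.

  For the strictness of \<open>H <LT I\<close>, let \<open>\<phi>\<close> determine a partial continuous \<open>\<Phi>\<close>. Call a node \<open>\<sigma>\<close>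
  \<open>forced\<close> into \<open>A\<close> if the opponent of a player who leaves out only a set in \<open>I\<close> at every move can
  make sure, from \<open>\<sigma>\<close> on, that the value of \<open>\<Phi>\<close> falls into \<open>A\<close>. The game is open for this opponent,
  so being forced is an inductive notion. A tree that witnesses the reduction for the complement of
  \<open>A\<close> contains no node forced into \<open>A\<close> (\<open>forced_notin_tree\<close>), so it suffices to find \<open>A \<in> H\<close> such
  that the root is forced into \<open>A\<close>.

  Suppose that the root is not forced into any singleton. The families \<open>I\<close> in question consist of
  sets with few elements in almost all blocks (\<open>block_sparse\<close>), so a set is not in \<open>I\<close> as
  soon as it contains sufficiently many large finite pieces of blocks. Consider a node that is not
  forced into any singleton. If its children that are forced into singletons \<open>{c}\<close> with \<open>c\<close> arbitrarily
  large fill such pieces (\<open>scattered\<close>), then the node is forced into any set that contains the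
  values of the right countably many finite pieces. There are countably many nodes, and the values can be chosen as far out
  as desired, so all scattered nodes are forced into a single \<open>A \<in> H\<close>
  (\<open>forcing_set_exists\<close>). At a node forced neither into a singleton nor into \<open>A\<close>, the children that are forced into a singleton, those that are forced into \<open>A\<close>, and those
  outside a given \<open>I\<close>-dual branching tree are covered by finitely many members of the proper ideal
  \<open>ED_fin\<close>. Hence, unless the root is forced into \<open>A\<close>, one can follow the tree forever
  through nodes that are not forced into any singleton. At such nodes \<open>\<phi>\<close> is undefined, so \<open>\<Phi>\<close> is
  undefined on the resulting path, a contradiction (\<open>not_LT_le_block_sparse\<close>).

  What remains is how much room \<open>H\<close> has (\<open>absorbs_thin\<close>). To leave \<open>ED_fin_bound m\<close> the pieces need
  \<open>m + 1\<close> elements, and putting the values of different pieces into different blocks gives a set in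
  \<open>ED_fin_bound (m + 1)\<close>. To leave \<open>ED_fin\<close> the pieces need unboundedly many elements, which is too
  much for \<open>ED_fin\<close> itself; but values that are sufficiently large keep the sum of reciprocals finite.
\<close>

section \<open>Blocks\<close>

definition block_start :: "nat \<Rightarrow> nat" where
  "block_start a = (\<Sum>i<a. i)"

lemma block_eq: "block a = {block_start a..<block_start a + a}"
  by (simp add: block_def block_start_def)

lemma finite_block [simp]: "finite (block a)"
  by (simp add: block_eq)

lemma card_block [simp]: "card (block a) = a"
  by (simp add: block_eq)

lemma block_start_mono: "a \<le> b \<Longrightarrow> block_start a \<le> block_start b"
  unfolding block_start_def by (rule sum_mono2) auto

lemma twice_block_start: "2 * block_start a + a = a * a"
  by (induction a) (auto simp: block_start_def)

lemma block_exhaust: obtains a where "x \<in> block a"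
proof -
  have "x < block_start (Suc n) \<Longrightarrow> \<exists>a. x \<in> block a" for n
  proof (induction n)
    case (Suc n)
    show ?case
    proof (cases "x < block_start (Suc n)")
      case False
      with Suc.prems have "x \<in> block (Suc n)" by (simp add: block_eq block_start_def)
      then show ?thesis by blast
    qed (use Suc.IH in blast)
  qed (simp add: block_start_def)
  moreover have "x < block_start (Suc (Suc x))"
    by (simp add: block_start_def)
  ultimately show ?thesis using that by blast
qed

lemma less_block_start:
  assumes "x \<in> block a" "a < b" shows "x < block_start b"
  using assms block_start_mono[of "Suc a" b] by (auto simp: block_eq block_start_def)

text \<open>Missing a block altogether is having at most \<open>0\<close> elements in it. This puts \<open>Fin\<close> at the
  bottom of the family \<open>ED_fin_bound\<close>, so that it needs no separate treatment.\<close>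

lemma finite_iff_ED_fin_bound_0: "finite A \<longleftrightarrow> A \<in> ED_fin_bound 0"
proof
  assume "finite A"
  then obtain N where N: "\<And>x. x \<in> A \<Longrightarrow> x < N"
    by (metis finite_nat_set_iff_bounded)
  have "A \<inter> block n = {}" if "n \<ge> N + 2" for n
  proof -
    have "block_start (Suc (Suc N)) \<le> block_start n"
      using that by (intro block_start_mono) simp
    moreover have "N \<le> block_start (Suc (Suc N))" by (simp add: block_start_def)
    ultimately show ?thesis using N by (fastforce simp: block_eq)
  qed
  then have "\<forall>n\<ge>N + 2. card (A \<inter> block n) \<le> 0" by simp
  then show "A \<in> ED_fin_bound 0"
    unfolding ED_fin_bound_def MOST_nat_le by blast
next
  assume "A \<in> ED_fin_bound 0"
  then obtain N where N: "\<And>n. n \<ge> N \<Longrightarrow> A \<inter> block n = {}"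
    unfolding ED_fin_bound_def MOST_nat_le by auto
  have "A \<subseteq> {..<block_start N}"
  proof
    fix x assume "x \<in> A"
    obtain a where a: "x \<in> block a" by (rule block_exhaust)
    with N[of a] \<open>x \<in> A\<close> have "a < N" by (meson disjoint_iff not_le)
    with a show "x \<in> {..<block_start N}" by (simp add: less_block_start)
  qed
  then show "finite A" by (rule finite_subset) simp
qed

lemma Fin_eq: "Fin = ED_fin_bound 0"
  by (auto simp: Fin_def finite_iff_ED_fin_bound_0)

section \<open>The lower sets\<close>

lemma dual_family_iff: "X \<in> dual_family L \<longleftrightarrow> - X \<in> L"
  unfolding dual_family_def by (auto simp: Compl_eq_Diff_UNIV[symmetric] intro: exI[of _ "- X"])

lemma lower_set_iff:
  "lower_set L \<longleftrightarrow> L \<noteq> {} \<and> (\<forall>A\<in>L. \<forall>B\<subseteq>A. B \<in> L) \<and> UNIV \<notin> L" (is "?l \<longleftrightarrow> ?r")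
proof -
  have "?l \<longleftrightarrow> (\<exists>X. - X \<in> L) \<and> (\<forall>A. - A \<in> L \<longrightarrow> (\<forall>B. A \<subseteq> B \<longrightarrow> - B \<in> L)) \<and> UNIV \<notin> L"
    unfolding lower_set_def upper_set_def using dual_family_iff[of _ L] by auto
  also have "\<dots> \<longleftrightarrow> ?r"
    by (metis Compl_subset_Compl_iff double_complement ex_in_conv)
  finally show ?thesis .
qed

lemma ED_fin_bound_mono: "m \<le> m' \<Longrightarrow> ED_fin_bound m \<subseteq> ED_fin_bound m'"
  unfolding ED_fin_bound_def by (intro Collect_mono impI) (erule MOST_mono, simp)

lemma ED_fin_iff: "X \<in> ED_fin \<longleftrightarrow> (\<exists>m. X \<in> ED_fin_bound m)"
proof
  assume "\<exists>m. X \<in> ED_fin_bound m"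
  then obtain m where "X \<in> ED_fin_bound (Suc m)"
    using ED_fin_bound_mono[OF le_SucI[OF order_refl]] by blast
  then show "X \<in> ED_fin" unfolding ED_fin_def by auto
qed (auto simp: ED_fin_def)

lemma ED_fin_bound_subset: "X \<in> ED_fin_bound m \<Longrightarrow> Y \<subseteq> X \<Longrightarrow> Y \<in> ED_fin_bound m"
  unfolding ED_fin_bound_def mem_Collect_eq
  by (erule MOST_mono, erule order_trans[rotated]) (intro card_mono, auto)

text \<open>Bounds on the number of elements per block add up, so a union of two sets stays in \<open>ED_fin\<close>,
  although it leaves \<open>ED_fin_bound m\<close> in general. This is why the covering argument
  in \<open>not_LT_le_block_sparse\<close> takes place in \<open>ED_fin\<close>.\<close>

lemma ED_fin_Un: 
  assumes "X \<in> ED_fin" "Y \<in> ED_fin" shows "X \<union> Y \<in> ED_fin"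
proof -
  obtain a b where "X \<in> ED_fin_bound a" "Y \<in> ED_fin_bound b"
    using assms ED_fin_iff by blast
  then have "\<forall>\<^sub>\<infinity>n. card (X \<inter> block n) \<le> a \<and> card (Y \<inter> block n) \<le> b"
    unfolding ED_fin_bound_def by (simp add: MOST_conj_distrib)
  then have "X \<union> Y \<in> ED_fin_bound (a + b)"
    unfolding ED_fin_bound_def mem_Collect_eq
    by (rule MOST_mono)
      (metis Int_Un_distrib2 add_mono card_Un_le order_trans)
  then show ?thesis using ED_fin_iff by blast
qed

lemma UNIV_notin_ED_fin: "UNIV \<notin> ED_fin"
proof
  assume "UNIV \<in> ED_fin"
  then obtain m where "UNIV \<in> ED_fin_bound m" unfolding ED_fin_iff by blast
  then obtain N where "\<forall>n\<ge>N. n \<le> m"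
    unfolding ED_fin_bound_def MOST_nat_le by auto
  then have "N + Suc m \<le> m" by (meson le_add1)
  then show False by simp
qed

lemma ED_fin_omits:
  assumes "X \<in> ED_fin" obtains x where "x \<notin> X"
  using assms UNIV_notin_ED_fin by (cases "X = UNIV") auto

lemma lower_set_ED_fin_bound: "lower_set (ED_fin_bound m)"
proof -
  have "{} \<in> ED_fin_bound m" by (simp add: ED_fin_bound_def)
  moreover have "UNIV \<notin> ED_fin_bound m" using UNIV_notin_ED_fin ED_fin_iff by blast
  ultimately show ?thesis unfolding lower_set_iff using ED_fin_bound_subset by blast
qed

lemma lower_set_ED_fin: "lower_set ED_fin"
proof -
  have "{} \<in> ED_fin" by (simp add: ED_fin_iff ED_fin_bound_def)
  moreover have "B \<in> ED_fin" if "A \<in> ED_fin" "B \<subseteq> A" for A B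
    using that ED_fin_bound_subset unfolding ED_fin_iff by blast
  ultimately show ?thesis unfolding lower_set_iff using UNIV_notin_ED_fin by blast
qed

text \<open>The common source of members of \<open>Sum_recip\<close>: it serves both for the inclusion of \<open>ED_fin\<close>, with
  the traces on the blocks as pieces, and for the sets built from finite pieces far out. A possible
  element \<open>0\<close> does no harm since \<open>1 / 0 = 0\<close>.\<close>

lemma Sum_recip_UN:
  fixes D :: "nat \<Rightarrow> nat set" and b :: "nat \<Rightarrow> real"
  assumes fin: "\<And>j. finite (D j)" and b: "\<And>j. (\<Sum>x\<in>D j. 1 / real x) \<le> b j" and "summable b"
  shows "(\<Union>j. D j) \<in> Sum_recip"
proof -
  have b0: "0 \<le> b j" for j using b[of j] sum_nonneg[of "D j" "\<lambda>x. 1 / real x"] by force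
  have part: "(\<Sum>x\<in>(\<Union>j<J. D j). 1 / real x) \<le> (\<Sum>j<J. b j)" for J
  proof (induction J)
    case (Suc J)
    have "(\<Sum>x\<in>(\<Union>j<Suc J. D j). 1 / real x) = (\<Sum>x\<in>D J \<union> (\<Union>j<J. D j). 1 / real x)"
      by (simp add: lessThan_Suc)
    also have "\<dots> \<le> (\<Sum>x\<in>D J. 1 / real x) + (\<Sum>x\<in>(\<Union>j<J. D j). 1 / real x)"
      using fin by (subst sum_Un) (auto intro!: sum_nonneg)
    finally show ?case using Suc b[of J] by simp
  qed simp
  have "sum (\<lambda>x. 1 / real x) F \<le> suminf b"
    if F: "finite F" "F \<subseteq> {x \<in> \<Union>(range D). x > 0}" for F
  proof -
    have "\<forall>x\<in>F. \<exists>j. x \<in> D j" using F by blast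
    then obtain idx where idx: "\<And>x. x \<in> F \<Longrightarrow> x \<in> D (idx x)" by metis
    obtain J where "idx ` F \<subseteq> {..<J}"
      using F(1) finite_nat_iff_bounded[of "idx ` F"] by auto
    then have "F \<subseteq> (\<Union>j<J. D j)" using idx by blast
    then have "sum (\<lambda>x. 1 / real x) F \<le> (\<Sum>x\<in>(\<Union>j<J. D j). 1 / real x)"
      using fin by (intro sum_mono2) auto
    also have "\<dots> \<le> (\<Sum>j<J. b j)" by (rule part)
    also have "\<dots> \<le> suminf b" using assms b0 by (intro sum_le_suminf) auto
    finally show ?thesis .
  qed
  then show ?thesis unfolding Sum_recip_def mem_Collect_eq
    by (intro nonneg_bdd_above_summable_on bdd_aboveI2[of _ _ "suminf b"]) auto
qed

lemma lower_set_Sum_recip: "lower_set Sum_recip"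
proof -
  have "{} \<in> Sum_recip" by (simp add: Sum_recip_def)
  moreover have "B \<in> Sum_recip" if "A \<in> Sum_recip" "B \<subseteq> A" for A B
    using that unfolding Sum_recip_def mem_Collect_eq
    by (elim summable_on_subset_banach) auto
  moreover have "UNIV \<notin> Sum_recip"
  proof
    assume "UNIV \<in> Sum_recip"
    then have "(\<lambda>n. 1 / real n) summable_on {n. n > 0}" by (simp add: Sum_recip_def)
    then have "(\<lambda>n. 1 / real n) summable_on UNIV"
      by (rule summable_on_cong_neutral[THEN iffD1, rotated -1]) auto
    then have "summable (\<lambda>n. 1 / real n)" by (rule summable_on_imp_summable)
    then have "summable (\<lambda>n. inverse (real n))" by (simp add: inverse_eq_divide)
    then show False using not_summable_harmonic[where 'a = real] by simp
  qed
  ultimately show ?thesis unfolding lower_set_iff by blast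
qed

text \<open>An element of the \<open>n\<close>-th block is at least \<open>n (n - 1) / 2\<close>, which is at least \<open>n\<^sup>2 / 4\<close> for
  \<open>n \<ge> 2\<close>. The trace of a set in \<open>ED_fin\<close> on this block therefore contributes \<open>O(1 / n\<^sup>2)\<close>.\<close>

lemma ED_fin_subset_Sum_recip: "ED_fin \<subseteq> Sum_recip"
proof
  fix A assume "A \<in> ED_fin"
  then obtain m N where N: "\<And>n. n \<ge> N \<Longrightarrow> card (A \<inter> block n) \<le> m"
    unfolding ED_fin_iff ED_fin_bound_def MOST_nat_le by auto
  \<comment> \<open>The finitely many exceptional blocks have index below \<open>N\<close>, hence fewer than \<open>N\<close> elements.\<close>
  define M where "M = max m N"
  have M: "card (A \<inter> block n) \<le> M" for n
  proof (cases "n \<ge> N")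
    case False
    have "card (A \<inter> block n) \<le> card (block n)" by (intro card_mono) auto
    then show ?thesis using False by (simp add: M_def)
  qed (use N[of n] in \<open>simp add: M_def\<close>)
  have bound: "(\<Sum>x\<in>A \<inter> block n. 1 / real x) \<le> 4 * real M * inverse (real n ^ 2)" for n
  proof -
    have "1 / real x \<le> 4 / real n ^ 2" if "x \<in> A \<inter> block n" for x
    proof (cases "n \<le> 1")
      case True
      then have "x = 0" using that by (cases n) (auto simp: block_eq block_start_def)
      then show ?thesis by simp
    next
      case False
      have "n * n \<ge> 2 * n" using False by (intro mult_right_mono) auto
      then have "n * n \<le> 4 * block_start n" using twice_block_start[of n] by linarith
      also have "\<dots> \<le> 4 * x" using that by (simp add: block_eq)
      finally have "n ^ 2 \<le> 4 * x" by (simp add: power2_eq_square)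
      then have "real n ^ 2 \<le> 4 * real x" by (metis of_nat_le_iff of_nat_mult of_nat_numeral of_nat_power)
      moreover have "0 < real n ^ 2" using False by simp
      ultimately have "0 < real x" "real n ^ 2 * 1 \<le> 4 * real x" by linarith+
      with \<open>0 < real n ^ 2\<close> show ?thesis by (simp add: divide_le_eq le_divide_eq mult.commute)
    qed
    then have "(\<Sum>x\<in>A \<inter> block n. 1 / real x) \<le> real (card (A \<inter> block n)) * (4 / real n ^ 2)"
      by (rule sum_bounded_above)
    also have "\<dots> \<le> real M * (4 / real n ^ 2)" using M[of n] by (intro mult_right_mono) auto
    finally show ?thesis by (simp add: field_simps)
  qed
  have "(\<Union>n. A \<inter> block n) \<in> Sum_recip"
  proof (rule Sum_recip_UN)
    show "summable (\<lambda>n. 4 * real M * inverse (real n ^ 2))"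
      by (intro summable_mult inverse_power_summable) simp
  qed (use bound in auto)
  moreover have "(\<Union>n. A \<inter> block n) = A" using block_exhaust by blast
  ultimately show "A \<in> Sum_recip" by simp
qed

section \<open>Inclusions give reductions\<close>

text \<open>Monotonicity in the left argument transfers \<open>ED_fin_bound (Suc m)\<close> being irreducible to
  \<open>ED_fin_bound m\<close> to the larger family \<open>ED_fin\<close>.\<close>

lemma LT_le_subset_left: "H' \<subseteq> H \<Longrightarrow> H \<le>LT I \<Longrightarrow> H' \<le>LT I"
proof -
  assume "H' \<subseteq> H"
  then have "dual_family H' \<subseteq> dual_family H" by (auto simp: dual_family_def)
  then show "H \<le>LT I \<Longrightarrow> H' \<le>LT I" unfolding LT_le_def LT_upper_def by blast
qed

text \<open>The map \<open>\<Phi> p = p 0\<close> witnesses the reduction: the first move is restricted to the given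
  set of the dual family, and every later move is unrestricted.\<close>

lemma LT_le_if_subset:
  assumes "H \<subseteq> I" "lower_set I" shows "H \<le>LT I"
proof -
  define \<phi> :: "nat list \<rightharpoonup> nat" where "\<phi> \<sigma> = (if \<sigma> = [] then None else Some (hd \<sigma>))" for \<sigma>
  define \<Phi> :: "(nat \<Rightarrow> nat) \<rightharpoonup> nat" where "\<Phi> p = Some (p 0)" for p
  have "coherent \<phi>"
    unfolding coherent_def \<phi>_def by (auto simp: prefix_def)
  moreover have "\<Phi> p = Some c \<longleftrightarrow> (\<exists>n. \<phi> (initial_segment p n) = Some c)" for p c
    unfolding \<Phi>_def \<phi>_def initial_segment_def
    by (auto simp: hd_map split: if_splits intro: exI[of _ 1])
  ultimately have "partial_continuous \<Phi>" unfolding partial_continuous_def by blast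
  moreover have "\<exists>T. is_tree T \<and> branching (dual_family I) T \<and>
      paths T \<subseteq> dom \<Phi> \<and> (\<forall>p\<in>paths T. the (\<Phi> p) \<in> A)" if "A \<in> dual_family H" for A
  proof (intro exI conjI)
    let ?T = "{\<sigma>. \<sigma> = [] \<or> hd \<sigma> \<in> A}"
    show "is_tree ?T" unfolding is_tree_def by (auto simp: prefix_def hd_append split: if_splits)
    have "{n. \<sigma> @ [n] \<in> ?T} \<in> dual_family I" if "\<sigma> \<in> ?T" for \<sigma>
    proof (cases "\<sigma> = []")
      case True
      then show ?thesis using \<open>A \<in> dual_family H\<close> \<open>H \<subseteq> I\<close> by (auto simp: dual_family_iff)
    next
      case False
      have "{} \<in> I" using \<open>lower_set I\<close> unfolding lower_set_iff by (meson empty_subsetI equals0I)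
      then show ?thesis using False that by (simp add: dual_family_iff)
    qed
    then show "branching (dual_family I) ?T" unfolding branching_def by blast
    show "paths ?T \<subseteq> dom \<Phi>" by (auto simp: \<Phi>_def)
    have "p 0 \<in> A" if "p \<in> paths ?T" for p
    proof -
      have "initial_segment p 1 \<in> ?T" using that unfolding paths_def by blast
      then show ?thesis by (simp add: initial_segment_def)
    qed
    then show "\<forall>p\<in>paths ?T. the (\<Phi> p) \<in> A" by (simp add: \<Phi>_def)
  qed
  ultimately show ?thesis unfolding LT_le_def LT_upper_def by blast
qed

section \<open>Forcing a value into a set\<close>

text \<open>The least solution expresses that the value is reached after finitely many moves along
  every play. The set \<open>S\<close> is the opponent's choice of moves; a player who leaves out only a
  member of \<open>I\<close> cannot leave out all of \<open>S\<close>. Quantifying over \<open>S\<close>, rather than referring to the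
  set of all forced children, keeps the clauses monotone for an arbitrary \<open>I\<close>.\<close>

inductive forced :: "nat set set \<Rightarrow> (nat list \<rightharpoonup> nat) \<Rightarrow> nat set \<Rightarrow> nat list \<Rightarrow> bool"
  for I \<phi> A where
  forced_leaf: "\<phi> \<sigma> = Some c \<Longrightarrow> c \<in> A \<Longrightarrow> forced I \<phi> A \<sigma>"
| forced_node: "S \<notin> I \<Longrightarrow> (\<And>n. n \<in> S \<Longrightarrow> forced I \<phi> A (\<sigma> @ [n])) \<Longrightarrow> forced I \<phi> A \<sigma>"

lemma forced_mono: "forced I \<phi> A \<sigma> \<Longrightarrow> A \<subseteq> B \<Longrightarrow> forced I \<phi> B \<sigma>"
  by (induction rule: forced.induct) (auto intro: forced_leaf forced_node)

lemma forced_children: "\<not> forced I \<phi> A \<sigma> \<Longrightarrow> {n. forced I \<phi> A (\<sigma> @ [n])} \<in> I"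
  by (metis forced_node mem_Collect_eq)

text \<open>Dependent choice along a tree, used with two properties \<open>P\<close>: lying in a branching tree, and
  being a node of the tree at which nothing is decided yet.\<close>

lemma path_through:
  assumes "P \<sigma>" and step: "\<And>\<tau>. P \<tau> \<Longrightarrow> \<exists>n. P (\<tau> @ [n])"
  obtains p where "initial_segment p (length \<sigma>) = \<sigma>"
    and "\<And>n. length \<sigma> \<le> n \<Longrightarrow> P (initial_segment p n)"
proof -
  define s where "s = rec_nat \<sigma> (\<lambda>_ \<tau>. \<tau> @ [SOME n. P (\<tau> @ [n])])"
  have s0: "s 0 = \<sigma>" and sS: "s (Suc i) = s i @ [SOME n. P (s i @ [n])]" for i
    by (simp_all add: s_def)
  have P: "P (s i)" for i
  proof (induction i)
    case (Suc i)
    then show ?case unfolding sS using step by (metis someI)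
  qed (simp add: s0 assms)
  have len: "length (s i) = length \<sigma> + i" for i
    by (induction i) (simp_all add: s0 sS)
  have nth: "s (i + d) ! k = s i ! k" if "k < length (s i)" for i d k
    using that by (induction d) (simp_all add: sS len nth_append)
  define p where "p k = s (Suc k) ! k" for k
  have p: "initial_segment p (length \<sigma> + i) = s i" for i
  proof (rule nth_equalityI)
    fix k assume "k < length (initial_segment p (length \<sigma> + i))"
    then have k: "k < length \<sigma> + i" by (simp add: initial_segment_def)
    then have "initial_segment p (length \<sigma> + i) ! k = s (Suc k) ! k"
      by (simp add: initial_segment_def p_def)
    also have "\<dots> = s (Suc k + i) ! k" by (rule nth[symmetric]) (simp add: len)
    also have "\<dots> = s (i + Suc k) ! k" by (simp add: add.commute)
    also have "\<dots> = s i ! k" by (rule nth) (simp add: len k)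
    finally show "initial_segment p (length \<sigma> + i) ! k = s i ! k" .
  qed (simp add: initial_segment_def len)
  show ?thesis
  proof
    show "initial_segment p (length \<sigma>) = \<sigma>" using p[of 0] s0 by simp
    show "P (initial_segment p n)" if "length \<sigma> \<le> n" for n
      using p[of "n - length \<sigma>"] P[of "n - length \<sigma>"] that by simp
  qed
qed

lemma initial_segment_prefix: "m \<le> n \<Longrightarrow> prefix (initial_segment p m) (initial_segment p n)"
proof -
  assume "m \<le> n"
  then have "[0..<n] = [0..<m] @ [m..<n]" by (metis le_add_diff_inverse upt_add_eq_append zero_le)
  then show ?thesis by (simp add: initial_segment_def)
qed

text \<open>The two strategies cannot coexist. At a leaf of the derivation, \<open>\<sigma> \<in> T\<close> extends to a path of
  \<open>T\<close> whose value is already determined at \<open>\<sigma>\<close> and lies in \<open>A\<close>. At an inner node, a set \<open>S \<notin> I\<close>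
  disjoint from the successors in \<open>T\<close> would be contained in a member of \<open>I\<close>.\<close>

lemma forced_notin_tree:
  assumes "lower_set I" and \<phi>: "\<And>p c. \<Phi> p = Some c \<longleftrightarrow> (\<exists>n. \<phi> (initial_segment p n) = Some c)"
    and T: "is_tree T" "branching (dual_family I) T" and "\<forall>p\<in>paths T. the (\<Phi> p) \<notin> A"
    and "forced I \<phi> A \<sigma>"
  shows "\<sigma> \<notin> T"
  using \<open>forced I \<phi> A \<sigma>\<close>
proof (induction rule: forced.induct)
  case (forced_leaf \<sigma> c)
  show ?case
  proof
    assume "\<sigma> \<in> T"
    have "\<exists>n. \<tau> @ [n] \<in> T" if "\<tau> \<in> T" for \<tau>
    proof -
      have "- {n. \<tau> @ [n] \<in> T} \<in> I"
        using that T(2) unfolding branching_def dual_family_iff by blast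
      then have "- {n. \<tau> @ [n] \<in> T} \<noteq> UNIV"
        using \<open>lower_set I\<close> unfolding lower_set_iff by metis
      then show ?thesis by blast
    qed
    with \<open>\<sigma> \<in> T\<close> obtain p where p: "initial_segment p (length \<sigma>) = \<sigma>"
      and ext: "\<And>n. length \<sigma> \<le> n \<Longrightarrow> initial_segment p n \<in> T"
      using path_through[of "\<lambda>\<tau>. \<tau> \<in> T" \<sigma>] by blast
    have "initial_segment p n \<in> T" for n
      using ext[of "max n (length \<sigma>)"] initial_segment_prefix[of n "max n (length \<sigma>)" p] T(1)
      unfolding is_tree_def by auto
    then have "p \<in> paths T" by (simp add: paths_def)
    moreover have "\<Phi> p = Some c" using \<phi> p forced_leaf by metis
    ultimately show False using assms(5) forced_leaf by force
  qed
next
  case (forced_node S \<sigma>)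
  show ?case
  proof
    assume "\<sigma> \<in> T"
    then have "- {n. \<sigma> @ [n] \<in> T} \<in> I"
      using T(2) unfolding branching_def dual_family_iff by blast
    moreover have "S \<subseteq> - {n. \<sigma> @ [n] \<in> T}" using forced_node by blast
    ultimately show False using \<open>lower_set I\<close> forced_node unfolding lower_set_iff by blast
  qed
qed

section \<open>A criterion for irreducibility\<close>

text \<open>A uniform format for \<open>ED_fin_bound m\<close> (with \<open>e\<close> constantly \<open>m + 1\<close>) and \<open>ED_fin\<close> (with
  \<open>e = Suc\<close>). Its point is the description of the complement: a set lies outside if and only if, for
  every \<open>i\<close> and \<open>M\<close>, it contains \<open>e i\<close> elements of some block beyond \<open>M\<close>. These are countably many
  requirements, each of which is met by a finite piece.\<close>

definition block_sparse :: "(nat \<Rightarrow> nat) \<Rightarrow> nat set set" where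
  "block_sparse e = {X. \<exists>i. \<forall>\<^sub>\<infinity>n. card (X \<inter> block n) < e i}"

text \<open>The room that \<open>H\<close> leaves for finite pieces of prescribed sizes. The threshold \<open>t\<close> depends on \<open>j\<close>
  because sums of reciprocals need ever smaller contributions, and on the pieces placed before
  because the pieces may have to avoid the blocks used so far.\<close>

definition absorbs_thin :: "(nat \<Rightarrow> nat) \<Rightarrow> nat set set \<Rightarrow> bool" where
  "absorbs_thin k H \<longleftrightarrow> (\<exists>t. \<forall>D.
     (\<forall>j. finite (D j) \<and> card (D j) \<le> k j \<and> (\<forall>x\<in>D j. t j (\<Union>i<j. D i) \<le> x))
       \<longrightarrow> (\<Union>j. D j) \<in> H)"

text \<open>How \<open>absorbs_thin\<close> is used: if the \<open>j\<close>-th requirement can be met by a set of size \<open>k j\<close>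
  arbitrarily far out, then recursion along the thresholds gives one set that meets all of them.\<close>

lemma absorbs_thin_obtain:
  assumes "absorbs_thin k H"
    and ex: "\<And>j N. \<exists>D. finite D \<and> card D \<le> k j \<and> (\<forall>x\<in>D. N \<le> x) \<and> R j D"
  obtains D where "(\<Union>j. D j) \<in> H" "\<And>j. R j (D j)"
proof -
  obtain t where t: "\<And>D. (\<And>j. finite (D j) \<and> card (D j) \<le> k j \<and> (\<forall>x\<in>D j. t j (\<Union>i<j. D i) \<le> x))
       \<Longrightarrow> (\<Union>j. D j) \<in> H"
    using assms(1) unfolding absorbs_thin_def by metis
  obtain pick where pick: "\<And>j N. finite (pick j N) \<and> card (pick j N) \<le> k j
      \<and> (\<forall>x\<in>pick j N. N \<le> x) \<and> R j (pick j N)"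
    using ex by metis
  \<comment> \<open>\<open>E j\<close> collects the pieces before the \<open>j\<close>-th one, on which the next threshold depends.\<close>
  define E where "E = rec_nat {} (\<lambda>j F. F \<union> pick j (t j F))"
  define D where "D j = pick j (t j (E j))" for j
  have E: "E j = (\<Union>i<j. D i)" for j
    by (induction j) (auto simp: E_def D_def lessThan_Suc)
  have "(\<Union>j. D j) \<in> H"
    by (rule t) (use pick in \<open>simp flip: E, simp add: D_def\<close>)
  moreover have "R j (D j)" for j using pick by (simp add: D_def)
  ultimately show ?thesis by (rule that)
qed

lemma block_sparse_subset_ED_fin: "block_sparse e \<subseteq> ED_fin"
proof
  fix X assume "X \<in> block_sparse e"
  then obtain i where "\<forall>\<^sub>\<infinity>n. card (X \<inter> block n) < e i" unfolding block_sparse_def by blast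
  then have "X \<in> ED_fin_bound (e i)"
    unfolding ED_fin_bound_def mem_Collect_eq by (rule MOST_mono) simp
  then show "X \<in> ED_fin" using ED_fin_iff by blast
qed

text \<open>Discarding the children whose values lie below some bound leaves the opponent at \<open>\<sigma>\<close> with
  enough decided children: those with values from \<open>N\<close> on form a set outside \<open>block_sparse e\<close>, whatever
  \<open>N\<close> is. So the values that the opponent aims at can be taken as far out as \<open>H\<close> requires.\<close>

definition scattered :: "nat set set \<Rightarrow> (nat list \<rightharpoonup> nat) \<Rightarrow> (nat \<Rightarrow> nat) \<Rightarrow> nat list \<Rightarrow> bool" where
  "scattered I \<phi> e \<sigma> \<longleftrightarrow>
     (\<forall>i N M. \<exists>n\<ge>M. e i \<le> card {x \<in> block n. \<exists>c\<ge>N. forced I \<phi> {c} (\<sigma> @ [x])})"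

text \<open>A requirement is a triple of a scattered node \<open>\<sigma>\<close>, an index \<open>i\<close>, and a bound \<open>M\<close>. It is met by
  picking \<open>e i\<close> children of \<open>\<sigma>\<close> in one block beyond \<open>M\<close>, together with one value for each of them. The
  values form a piece of at most \<open>e i\<close> elements that can be taken beyond any threshold, and
  there are only countably many requirements.\<close>

lemma forcing_set_exists:
  assumes "\<And>q. absorbs_thin (e \<circ> q) H"
  obtains A where "A \<in> H" "\<And>\<sigma>. scattered (block_sparse e) \<phi> e \<sigma> \<Longrightarrow> forced (block_sparse e) \<phi> A \<sigma>"
proof -
  let ?F = "forced (block_sparse e) \<phi>" and ?S = "scattered (block_sparse e) \<phi> e"
  define req :: "nat \<Rightarrow> nat list \<times> nat \<times> nat" where "req = from_nat"
  define meets where "meets D = (\<lambda>(\<sigma>, i, M). ?S \<sigma> \<longrightarrow>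
      (\<exists>n\<ge>M. e i \<le> card {x \<in> block n. ?F D (\<sigma> @ [x])}))" for D
  have "\<exists>D. finite D \<and> card D \<le> e (fst (snd (req j))) \<and> (\<forall>x\<in>D. N \<le> x) \<and> meets D (req j)" for j N
  proof -
    obtain \<sigma> i M where j: "req j = (\<sigma>, i, M)" by (rule prod_cases3)
    show ?thesis
    proof (cases "?S \<sigma>")
      case True
      then obtain n where n: "n \<ge> M" "e i \<le> card {x \<in> block n. \<exists>c\<ge>N. ?F {c} (\<sigma> @ [x])}"
        unfolding scattered_def by blast
      obtain Y where Y: "Y \<subseteq> {x \<in> block n. \<exists>c\<ge>N. ?F {c} (\<sigma> @ [x])}" "card Y = e i" "finite Y"
        using obtain_subset_with_card_n[OF n(2)] .
      have "\<forall>x\<in>Y. \<exists>c. N \<le> c \<and> ?F {c} (\<sigma> @ [x])" using Y(1) by blast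
      then obtain v where v: "\<And>x. x \<in> Y \<Longrightarrow> N \<le> v x \<and> ?F {v x} (\<sigma> @ [x])"
        using bchoice[of Y "\<lambda>x c. N \<le> c \<and> ?F {c} (\<sigma> @ [x])"] by blast
      have "?F (v ` Y) (\<sigma> @ [x])" if "x \<in> Y" for x
        by (rule forced_mono) (use v that in auto)
      then have "Y \<subseteq> {x \<in> block n. ?F (v ` Y) (\<sigma> @ [x])}" using Y(1) by blast
      then have "e i \<le> card {x \<in> block n. ?F (v ` Y) (\<sigma> @ [x])}"
        using Y(2) card_mono[of "{x \<in> block n. ?F (v ` Y) (\<sigma> @ [x])}" Y] by simp
      moreover have "card (v ` Y) \<le> e i" using Y card_image_le by metis
      ultimately show ?thesis
        using n(1) Y(3) v by (intro exI[of _ "v ` Y"]) (auto simp: j meets_def)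
    next
      case False
      then show ?thesis by (intro exI[of _ "{}"]) (simp add: j meets_def)
    qed
  qed
  note meet = this
  have "absorbs_thin (\<lambda>j. e (fst (snd (req j)))) H"
    using assms[of "\<lambda>j. fst (snd (req j))"] by (simp add: o_def)
  from absorbs_thin_obtain[OF this meet]
  obtain D where D: "(\<Union>j. D j) \<in> H" "\<And>j. meets (D j) (req j)" by blast
  let ?A = "\<Union>j. D j"
  have "?F ?A \<sigma>" if "?S \<sigma>" for \<sigma>
  proof -
    have "{x. ?F ?A (\<sigma> @ [x])} \<notin> block_sparse e"
    proof
      assume "{x. ?F ?A (\<sigma> @ [x])} \<in> block_sparse e"
      then obtain i M where iM: "\<And>n. n \<ge> M \<Longrightarrow> card ({x. ?F ?A (\<sigma> @ [x])} \<inter> block n) < e i"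
        unfolding block_sparse_def MOST_nat_le by blast
      define j where "j = to_nat (\<sigma>, i, M)"
      have "req j = (\<sigma>, i, M)" by (simp add: req_def j_def)
      with D(2)[of j] that obtain n where n: "n \<ge> M" "e i \<le> card {x \<in> block n. ?F (D j) (\<sigma> @ [x])}"
        by (auto simp: meets_def)
      have "{x \<in> block n. ?F (D j) (\<sigma> @ [x])} \<subseteq> {x. ?F ?A (\<sigma> @ [x])} \<inter> block n"
        by (auto intro: forced_mono)
      then have "e i \<le> card ({x. ?F ?A (\<sigma> @ [x])} \<inter> block n)"
        using n(2) by (meson card_mono finite_Int finite_block order_trans)
      with iM[OF n(1)] show False by simp
    qed
    then show ?thesis using forced_children by metis
  qed
  with D(1) show ?thesis by (rule that)
qed

text \<open>With \<open>A\<close> from \<open>forcing_set_exists\<close>, consider the nodes of a tree \<open>T\<close> that are forced neither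
  into a singleton nor into \<open>A\<close>. The root is one of them, because \<open>A\<close> and all singletons are in \<open>H\<close>.
  Such a node is not scattered, since scattered nodes are forced into \<open>A\<close>; so \<open>ED_fin\<close> contains the set of its children with large
  values, for some bound \<open>N\<close>, and also the sets of children with each of the finitely many
  smaller values. Hence it has a child of the same kind, and there is a path of \<open>T\<close>
  along which \<open>\<Phi>\<close> is undefined.\<close>

theorem not_LT_le_block_sparse:
  assumes low: "lower_set (block_sparse e)" and absorb: "\<And>q. absorbs_thin (e \<circ> q) H"
    and sing: "\<And>c. {c} \<in> H"
  shows "\<not> H \<le>LT block_sparse e"
proof
  define I where "I = block_sparse e"
  assume "H \<le>LT block_sparse e"
  then obtain \<Phi> where \<Phi>: "partial_continuous \<Phi>"
    and "\<forall>A\<in>dual_family H. \<exists>T. is_tree T \<and> branching (dual_family I) T \<and>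
           paths T \<subseteq> dom \<Phi> \<and> (\<forall>p\<in>paths T. the (\<Phi> p) \<in> A)"
    unfolding LT_le_def LT_upper_def I_def by blast
  then have tree: "\<exists>T. is_tree T \<and> branching (dual_family I) T \<and>
           paths T \<subseteq> dom \<Phi> \<and> (\<forall>p\<in>paths T. the (\<Phi> p) \<notin> A)" if "A \<in> H" for A
    using that by (metis Compl_iff double_complement dual_family_iff)
  obtain \<phi> where \<phi>: "\<And>p c. \<Phi> p = Some c \<longleftrightarrow> (\<exists>n. \<phi> (initial_segment p n) = Some c)"
    using \<Phi> unfolding partial_continuous_def by blast
  have root: "\<not> forced I \<phi> A []" if "A \<in> H" for A
    using tree[OF that] forced_notin_tree[OF low[folded I_def] \<phi>, of _ A "[]"] 
    unfolding is_tree_def by metis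
  \<comment> \<open>The purpose of \<open>T\<close> is that \<open>\<Phi>\<close> is defined on all its paths; the singleton \<open>{0}\<close> is an arbitrary choice.\<close>
  obtain T where T: "is_tree T" "branching (dual_family I) T" "paths T \<subseteq> dom \<Phi>"
    using tree[OF sing[of 0]] by blast
  obtain A where A: "A \<in> H" "\<And>\<sigma>. scattered I \<phi> e \<sigma> \<Longrightarrow> forced I \<phi> A \<sigma>"
    using forcing_set_exists[OF absorb, of \<phi>] unfolding I_def by blast
  define P where "P \<sigma> \<longleftrightarrow> \<sigma> \<in> T \<and> (\<forall>c. \<not> forced I \<phi> {c} \<sigma>) \<and> \<not> forced I \<phi> A \<sigma>" for \<sigma>
  have I_ED: "X \<in> ED_fin" if "X \<in> I" for X
    using that block_sparse_subset_ED_fin unfolding I_def by blast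
  have step: "\<exists>n. P (\<sigma> @ [n])" if "P \<sigma>" for \<sigma>
  proof -
    from that A have "\<not> scattered I \<phi> e \<sigma>" unfolding P_def by blast
    then obtain i N M where
      "\<And>n. n \<ge> M \<Longrightarrow> card {x \<in> block n. \<exists>c\<ge>N. forced I \<phi> {c} (\<sigma> @ [x])} < e i"
      unfolding scattered_def not_le[symmetric] by blast
    then have "\<And>n. n \<ge> M \<Longrightarrow> card ({x. \<exists>c\<ge>N. forced I \<phi> {c} (\<sigma> @ [x])} \<inter> block n) < e i"
      by (simp add: Int_def conj_commute)
    then have "{x. \<exists>c\<ge>N. forced I \<phi> {c} (\<sigma> @ [x])} \<in> I"
      unfolding I_def block_sparse_def MOST_nat_le by blast
    then have large: "{x. \<exists>c\<ge>N. forced I \<phi> {c} (\<sigma> @ [x])} \<in> ED_fin" by (rule I_ED)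
    have small: "{x. \<exists>c<K. forced I \<phi> {c} (\<sigma> @ [x])} \<in> ED_fin" for K
    proof (induction K)
      case 0
      show ?case by (simp add: ED_fin_iff ED_fin_bound_def)
    next
      case (Suc K)
      have "{x. forced I \<phi> {K} (\<sigma> @ [x])} \<in> ED_fin"
        using \<open>P \<sigma>\<close> by (intro I_ED forced_children) (simp add: P_def)
      from ED_fin_Un[OF this Suc] show ?case
        by (rule back_subst[of "\<lambda>X. X \<in> ED_fin"]) (auto simp: less_Suc_eq)
    qed
    have hit: "{x. forced I \<phi> A (\<sigma> @ [x])} \<in> ED_fin"
      using \<open>P \<sigma>\<close> by (intro I_ED forced_children) (simp add: P_def)
    have "- {x. \<sigma> @ [x] \<in> T} \<in> I"
      using \<open>P \<sigma>\<close> T(2) unfolding P_def branching_def dual_family_iff by blast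
    then have outside: "- {x. \<sigma> @ [x] \<in> T} \<in> ED_fin" by (rule I_ED)
    have "{x. \<exists>c\<ge>N. forced I \<phi> {c} (\<sigma> @ [x])} \<union> {x. \<exists>c<N. forced I \<phi> {c} (\<sigma> @ [x])}
        \<union> {x. forced I \<phi> A (\<sigma> @ [x])} \<union> - {x. \<sigma> @ [x] \<in> T} \<in> ED_fin" (is "?X \<in> _")
      by (intro ED_fin_Un large small hit outside)
    then obtain x where "x \<notin> ?X" by (rule ED_fin_omits)
    then have x: "\<sigma> @ [x] \<in> T" "\<not> forced I \<phi> A (\<sigma> @ [x])"
      "\<And>c. c \<ge> N \<Longrightarrow> \<not> forced I \<phi> {c} (\<sigma> @ [x])" "\<And>c. c < N \<Longrightarrow> \<not> forced I \<phi> {c} (\<sigma> @ [x])"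
      by auto
    then have "\<not> forced I \<phi> {c} (\<sigma> @ [x])" for c by (cases "c < N") auto
    with x show ?thesis unfolding P_def by blast
  qed
  have "P []"
    using root sing A(1) T(1) unfolding P_def is_tree_def by blast
  then obtain p where p: "\<And>n. P (initial_segment p n)"
    using path_through[of P "[]", OF _ step] by auto
  then have "p \<in> paths T" unfolding paths_def P_def by blast
  then obtain c where "\<Phi> p = Some c" using T(3) by blast
  then obtain n where "\<phi> (initial_segment p n) = Some c" using \<phi> by blast
  then have "forced I \<phi> {c} (initial_segment p n)" by (auto intro: forced_leaf)
  then show False using p[of n] unfolding P_def by blast
qed

section \<open>Thin unions in the lower sets\<close>

lemma ED_fin_bound_eq_block_sparse: "ED_fin_bound m = block_sparse (\<lambda>_. Suc m)"
  unfolding ED_fin_bound_def block_sparse_def by (simp add: less_Suc_eq_le)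

lemma ED_fin_eq_block_sparse: "ED_fin = block_sparse Suc"
  unfolding block_sparse_def by (auto simp: ED_fin_iff ED_fin_bound_def less_Suc_eq_le)

lemma singleton_in_ED_fin_bound: "{c} \<in> ED_fin_bound m"
  using finite_iff_ED_fin_bound_0[of "{c}"] ED_fin_bound_mono[of 0 m] by auto

text \<open>The threshold is the start of the first block after all elements collected so far. No
  block then meets two different pieces, so each block has at most as many elements as one piece.\<close>

lemma absorbs_thin_ED_fin_bound: "absorbs_thin (\<lambda>_. m) (ED_fin_bound m)"
proof -
  obtain blk where blk: "\<And>x. x \<in> block (blk x)" by (metis block_exhaust)
  define t :: "nat \<Rightarrow> nat set \<Rightarrow> nat" where "t j E = block_start (Suc (Max (insert 0 (blk ` E))))" for j E
  have blk_eq: "blk x = a" if "x \<in> block a" for x a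
    using that blk[of x] less_block_start[of x a "blk x"] less_block_start[of x "blk x" a]
    by (cases a "blk x" rule: linorder_cases) (auto simp: block_eq)
  have "(\<Union>j. D j) \<in> ED_fin_bound m"
    if D: "\<And>j. finite (D j) \<and> card (D j) \<le> m \<and> (\<forall>x\<in>D j. t j (\<Union>i<j. D i) \<le> x)" for D
  proof -
    have sep: "blk y < blk x" if "x \<in> D j" "y \<in> D i" "i < j" for x y i j
    proof -
      have fin: "finite (\<Union>i<j. D i)" using D by blast
      have "blk y \<le> Max (insert 0 (blk ` (\<Union>i<j. D i)))"
        using fin that by (intro Max_ge) auto
      moreover have "block_start (Suc (Max (insert 0 (blk ` (\<Union>i<j. D i))))) \<le> x"
        using D[of j] that(1) by (simp add: t_def)
      then have "Suc (Max (insert 0 (blk ` (\<Union>i<j. D i)))) \<le> blk x"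
        using less_block_start[OF blk[of x]] by (meson not_le)
      ultimately show ?thesis by linarith
    qed
    have "card ((\<Union>j. D j) \<inter> block n) \<le> m" for n
    proof (cases "(\<Union>j. D j) \<inter> block n = {}")
      case False
      then obtain x j where x: "x \<in> D j" "x \<in> block n" by blast
      have "(\<Union>j. D j) \<inter> block n \<subseteq> D j"
      proof
        fix y assume "y \<in> (\<Union>j. D j) \<inter> block n"
        then obtain i where y: "y \<in> D i" "y \<in> block n" by blast
        have "blk x = blk y" using x y blk_eq by simp
        then have "i = j" using sep[OF x(1) y(1)] sep[OF y(1) x(1)] by (cases i j rule: linorder_cases) auto
        then show "y \<in> D j" using y by simp
      qed
      then show ?thesis using D[of j] by (meson card_mono order_trans)
    qed simp
    then show ?thesis by (simp add: ED_fin_bound_def)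
  qed
  then show ?thesis unfolding absorbs_thin_def by blast
qed

text \<open>Beyond \<open>(k j + 1) 2\<^sup>j\<close>, a piece of \<open>k j\<close> elements contributes at most \<open>2\<^sup>-\<^sup>j\<close> to the sum of reciprocals,
  whatever the sizes \<open>k j\<close> are. The summand \<open>1\<close> keeps the threshold positive if \<open>k j = 0\<close>.\<close>

lemma absorbs_thin_Sum_recip: "absorbs_thin k Sum_recip"
proof -
  have "(\<Union>j. D j) \<in> Sum_recip"
    if D: "\<And>j. finite (D j) \<and> card (D j) \<le> k j \<and> (\<forall>x\<in>D j. Suc (k j) * 2 ^ j \<le> x)" for D
  proof (rule Sum_recip_UN)
    show "finite (D j)" for j using D by blast
    show "(\<Sum>x\<in>D j. 1 / real x) \<le> (1 / 2) ^ j" for j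
    proof -
      have "1 / real x \<le> 1 / (real (Suc (k j)) * 2 ^ j)" if "x \<in> D j" for x
      proof -
        have "Suc (k j) * 2 ^ j \<le> x" using D that by blast
        then have "real (Suc (k j)) * 2 ^ j \<le> real x" 
          by (metis of_nat_le_iff of_nat_mult of_nat_numeral of_nat_power)
        moreover have "0 < real (Suc (k j)) * 2 ^ j" by simp
        ultimately show ?thesis by (intro frac_le) linarith+
      qed
      then have "(\<Sum>x\<in>D j. 1 / real x) \<le> real (card (D j)) * (1 / (real (Suc (k j)) * 2 ^ j))"
        by (rule sum_bounded_above)
      also have "\<dots> \<le> real (Suc (k j)) * (1 / (real (Suc (k j)) * 2 ^ j))"
      proof (rule mult_right_mono)
        show "real (card (D j)) \<le> real (Suc (k j))"
          using D[of j] by (simp only: of_nat_le_iff) linarith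
      qed simp
      also have "\<dots> = (1 / 2) ^ j" by (simp add: power_one_over)
      finally show ?thesis .
    qed
    show "summable (\<lambda>j. (1 / 2 :: real) ^ j)" by (rule summable_geometric) simp
  qed
  then show ?thesis unfolding absorbs_thin_def by (intro exI[of _ "\<lambda>j _. Suc (k j) * 2 ^ j"]) blast
qed

section \<open>The chain\<close>

text \<open>A set lies outside \<open>ED_fin_bound m\<close> because of pieces of exactly \<open>m + 1\<close> elements, which is the
  size of pieces that \<open>ED_fin_bound (m + 1)\<close> can absorb.\<close>

lemma ED_fin_bound_Suc_not_LT_le: "\<not> ED_fin_bound (Suc m) \<le>LT ED_fin_bound m"
  unfolding ED_fin_bound_eq_block_sparse[of m]
proof (rule not_LT_le_block_sparse)
  show "lower_set (block_sparse (\<lambda>_. Suc m))"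
    using lower_set_ED_fin_bound[of m] by (simp add: ED_fin_bound_eq_block_sparse)
  show "absorbs_thin ((\<lambda>_. Suc m) \<circ> q) (ED_fin_bound (Suc m))"
    for q :: "nat \<Rightarrow> nat"
    using absorbs_thin_ED_fin_bound by (simp add: o_def)
qed (rule singleton_in_ED_fin_bound)

lemma Sum_recip_not_LT_le_ED_fin: "\<not> Sum_recip \<le>LT ED_fin"
  unfolding ED_fin_eq_block_sparse
proof (rule not_LT_le_block_sparse)
  show "lower_set (block_sparse Suc)"
    using lower_set_ED_fin by (simp add: ED_fin_eq_block_sparse)
  show "{c} \<in> Sum_recip" for c
    using ED_fin_subset_Sum_recip singleton_in_ED_fin_bound ED_fin_iff by blast
qed (rule absorbs_thin_Sum_recip)

lemma ED_fin_bound_LT_less_Suc: "ED_fin_bound m <LT ED_fin_bound (Suc m)"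
  unfolding LT_less_def
  using LT_le_if_subset[OF ED_fin_bound_mono[of m "Suc m"] lower_set_ED_fin_bound]
    ED_fin_bound_Suc_not_LT_le[of m]
  by simp

lemma ED_fin_bound_LT_less_ED_fin: "ED_fin_bound m <LT ED_fin"
proof -
  have sub: "ED_fin_bound k \<subseteq> ED_fin" for k by (auto simp: ED_fin_iff)
  have "\<not> ED_fin \<le>LT ED_fin_bound m"
    using LT_le_subset_left[OF sub[of "Suc m"], of "ED_fin_bound m"]
      ED_fin_bound_Suc_not_LT_le[of m] by blast
  then show ?thesis
    unfolding LT_less_def using LT_le_if_subset[OF sub[of m] lower_set_ED_fin] by blast
qed

lemma ED_fin_LT_less_Sum_recip: "ED_fin <LT Sum_recip"
  unfolding LT_less_def
  using LT_le_if_subset[OF ED_fin_subset_Sum_recip lower_set_Sum_recip] Sum_recip_not_LT_le_ED_fin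
  by blast

theorem theoremC:
  shows "lower_set Fin \<and> (\<forall>m\<ge>1. lower_set (ED_fin_bound m)) \<and>
           lower_set ED_fin \<and> lower_set Sum_recip \<and>
         Fin <LT ED_fin_bound 1 \<and>
         (\<forall>m\<ge>1. ED_fin_bound m <LT ED_fin_bound (m + 1)) \<and>
         (\<forall>m\<ge>1. ED_fin_bound m <LT ED_fin) \<and>
         ED_fin <LT Sum_recip"
proof (intro conjI allI impI)
  show "lower_set Fin" unfolding Fin_eq by (rule lower_set_ED_fin_bound)
  show "Fin <LT ED_fin_bound 1"
    unfolding Fin_eq One_nat_def by (rule ED_fin_bound_LT_less_Suc)
  show "ED_fin_bound m <LT ED_fin_bound (m + 1)" for m
    unfolding Suc_eq_plus1[symmetric] by (rule ED_fin_bound_LT_less_Suc)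
qed (rule lower_set_ED_fin_bound lower_set_ED_fin lower_set_Sum_recip
    ED_fin_bound_LT_less_ED_fin ED_fin_LT_less_Sum_recip)+

end
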